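(* Let $T>0$ and $e\in\mathbb R$, $e\neq 0$. For all $N\ge 1$, the truncated matrices $A_{11}^N=(a_{mn})_{0\le m,n\le N}$ and $D_{11}^N=(d_{mn})_{0\le m,n\le N}$ satisfy $$A_{11}^N D_{11}^N+(D_{11}^N)^T A_{11}^N\neq 0 .$$
   Context: $\mathbb N=\{0,1,2,\dots\}$. $H_m$ denotes the (physicists') Hermite polynomial, $H_m(x)=(-1)^m e^{x^2}\frac{d^m}{dx^m}e^{-x^2}$. For a fixed $T>0$ the asymmetric Hermite functions are $\psi_m(v)=e^{-v^2/T}T^{-\frac12}(2^m m!\sqrt{\pi})^{-\frac12}H_m(v/\sqrt T)$, $m\in\mathbb N$. The Gram coefficients are $a_{mn}=\int_{\mathbb R}\psi_m(v)\psi_n(v)\,dv$. The real number $e$ is the electric field, and $d_{mn}=-e\sqrt{\frac{2m}{T}}\,\delta_{m-1,n}$ for $m,n\in\mathbb N$ ($\delta$ is the Kronecker symbol), so only the first diagonal below the main diagonal is nonzero. *)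

theory Defs
  imports "HOL-Analysis.Analysis" "Jordan_Normal_Form.Matrix"
begin

definition hermite :: "nat \<Rightarrow> real \<Rightarrow> real" where
  "hermite m x = (- 1) ^ m * exp (x\<^sup>2) * (deriv ^^ m) (\<lambda>y. exp (- (y\<^sup>2))) x"

definition asym_hermite :: "real \<Rightarrow> nat \<Rightarrow> real \<Rightarrow> real" where
  "asym_hermite T m v =
     exp (- (v\<^sup>2) / T) * T powr (- 1 / 2) * (2 ^ m * fact m * sqrt pi) powr (- 1 / 2)
       * hermite m (v / sqrt T)"

definition gram_coeff :: "real \<Rightarrow> nat \<Rightarrow> nat \<Rightarrow> real" where
  "gram_coeff T m n = (LINT v|lborel. asym_hermite T m v * asym_hermite T n v)"

(* The Kronecker condition m - 1 = n is read in the integers, so it never holds for m = 0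
   (truncated subtraction on nat would give 0 - 1 = 0). *)
definition field_coeff :: "real \<Rightarrow> real \<Rightarrow> nat \<Rightarrow> nat \<Rightarrow> real" where
  "field_coeff T e m n = - e * sqrt (2 * real m / T) * (if int m - 1 = int n then 1 else 0)"

(* Indices run over 0..N inclusive, so the truncations have size N + 1. The name of the matrix
   constructor is qualified because HOL-Analysis also has a constant mat. *)
definition gram_mat :: "real \<Rightarrow> nat \<Rightarrow> real mat" where
  "gram_mat T N = Matrix.mat (N + 1) (N + 1) (\<lambda>(m, n). gram_coeff T m n)"

definition field_mat :: "real \<Rightarrow> real \<Rightarrow> nat \<Rightarrow> real mat" where
  "field_mat T e N = Matrix.mat (N + 1) (N + 1) (\<lambda>(m, n). field_coeff T e m n)"

end

theory Submission
  imports Defs "HOL-Probability.Distributions"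
begin

text \<open>
  Only the first subdiagonal of the field matrix is nonzero, and its last column vanishes. Hence in
  the entry at row \<open>N\<close> and column \<open>N - 1\<close> the second product contributes nothing, and the
  first contributes \<open>a\<^sub>N\<^sub>N d\<^sub>N\<^sub>,\<^sub>N\<^sub>-\<^sub>1\<close>. Here \<open>a\<^sub>N\<^sub>N > 0\<close>, being the integral of the
  square of a nonzero polynomial times a Gaussian.
\<close>

lemma deriv_poly_times_gaussian:
  fixes p :: "real poly"
  shows "deriv (\<lambda>y. poly p y * exp (- (y\<^sup>2)))
    = (\<lambda>y. poly (pderiv p - [:0, 2:] * p) y * exp (- (y\<^sup>2)))"
proof
  fix x :: real
  have "((\<lambda>y. poly p y * exp (- (y\<^sup>2))) has_real_derivative
      poly (pderiv p - [:0, 2:] * p) x * exp (- (x\<^sup>2))) (at x)"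
    by (auto intro!: derivative_eq_intros simp: algebra_simps)
  then show "deriv (\<lambda>y. poly p y * exp (- (y\<^sup>2))) x =
      poly (pderiv p - [:0, 2:] * p) x * exp (- (x\<^sup>2))"
    by (rule DERIV_imp_deriv)
qed

text \<open>Compare degrees: multiplication by \<open>[:0, 2:]\<close> raises the degree by one
  while \<open>pderiv\<close> never raises it, so the two terms cannot cancel.\<close>

lemma pderiv_minus_linear_times_nonzero:
  fixes p :: "real poly"
  assumes "p \<noteq> 0"
  shows "pderiv p - [:0, 2:] * p \<noteq> 0"
proof
  assume "pderiv p - [:0, 2:] * p = 0"
  then have "degree (pderiv p) = degree ([:0, 2:] * p)" by simp
  also have "\<dots> = Suc (degree p)"
    using assms by (subst degree_mult_eq) auto
  finally show False by (simp add: degree_pderiv)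
qed

text \<open>Each derivative replaces the polynomial factor \<open>p\<close> by
  \<open>pderiv p - [:0, 2:] * p\<close>. Nonvanishing is carried through the induction because the
  positivity of the Gram diagonal rests on it.\<close>

lemma higher_deriv_gaussian_poly:
  "\<exists>p :: real poly. p \<noteq> 0 \<and>
    (deriv ^^ m) (\<lambda>y. exp (- (y\<^sup>2))) = (\<lambda>y. poly p y * exp (- (y\<^sup>2)))"
proof (induction m)
  case 0
  show ?case by (intro exI[of _ 1]) simp
next
  case (Suc m)
  then obtain p :: "real poly" where "p \<noteq> 0"
    and "(deriv ^^ m) (\<lambda>y. exp (- (y\<^sup>2))) = (\<lambda>y. poly p y * exp (- (y\<^sup>2)))"
    by blast
  then show ?case
    using pderiv_minus_linear_times_nonzero[of p]
    by (intro exI[of _ "pderiv p - [:0, 2:] * p"])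
      (simp add: deriv_poly_times_gaussian del: mult_pCons_left)
qed

text \<open>The factor \<open>exp (x\<^sup>2)\<close> cancels the Gaussian, leaving the polynomial
  up to sign.\<close>

lemma hermite_poly: "\<exists>p. p \<noteq> 0 \<and> hermite m = poly p"
proof -
  obtain p :: "real poly" where p: "p \<noteq> 0"
    "(deriv ^^ m) (\<lambda>y. exp (- (y\<^sup>2))) = (\<lambda>y. poly p y * exp (- (y\<^sup>2)))"
    using higher_deriv_gaussian_poly by blast
  have "hermite m x = poly (Polynomial.smult ((- 1) ^ m) p) x" for x
    unfolding hermite_def p(2) by (simp add: exp_minus field_simps)
  with p(1) show ?thesis
    by (intro exI[of _ "Polynomial.smult ((- 1) ^ m) p"]) auto
qed

text \<open>By linearity this reduces to the moments of a centred normal distribution, all of which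
  are finite.\<close>

lemma integrable_normal_density_poly:
  fixes q :: "real poly"
  assumes "\<sigma> > 0"
  shows "integrable lborel (\<lambda>x. normal_density 0 \<sigma> x * poly q x)"
proof -
  have "integrable lborel (\<lambda>x. \<Sum>i\<le>degree q. coeff q i * (normal_density 0 \<sigma> x * x ^ i))"
    using integrable_normal_moment[OF assms, of 0] by (intro Bochner_Integration.integrable_sum integrable_mult_right) simp_all
  then show ?thesis
    by (simp add: poly_altdef sum_distrib_left mult_ac)
qed

text \<open>The integrand is nonnegative and vanishes only at the finitely many roots of
  \<open>q\<close>, a null set; a zero integral would make it vanish almost everywhere.\<close>

lemma integral_normal_density_poly_square_pos:
  fixes q :: "real poly"
  assumes "\<sigma> > 0" and "q \<noteq> 0"
  shows "(LINT x|lborel. normal_density 0 \<sigma> x * (poly q x)\<^sup>2) > 0"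
proof -
  let ?f = "\<lambda>x. normal_density 0 \<sigma> x * (poly q x)\<^sup>2"
  have int: "integrable lborel ?f"
    using integrable_normal_density_poly[OF assms(1), of "q\<^sup>2"] by simp
  have "AE x in lborel. x \<notin> {x. poly q x = 0}"
    using poly_roots_finite[OF assms(2)]
    by (intro AE_not_in finite_imp_null_set_lborel)
  then have nz: "AE x in lborel. ?f x \<noteq> 0"
    using normal_density_pos[OF assms(1)] by (auto elim!: eventually_mono simp: less_imp_neq[symmetric])
  have "integral\<^sup>L lborel ?f \<noteq> 0"
  proof
    assume "integral\<^sup>L lborel ?f = 0"
    then have "AE x in lborel. ?f x = 0"
      using integral_nonneg_eq_0_iff_AE[OF int] by simp
    with nz have "AE x in (lborel :: real measure). False"
      by eventually_elim simp
    \<comment> \<open>Otherwise the whole real line would be a Lebesgue null set.\<close>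
    then show False
      by (simp add: AE_iff_null null_sets_def)
  qed
  moreover have "integral\<^sup>L lborel ?f \<ge> 0"
    by (intro integral_nonneg_AE) simp
  ultimately show ?thesis by linarith
qed

lemma gram_coeff_diag_pos:
  assumes "T > 0"
  shows "gram_coeff T m m > 0"
proof -
  \<comment> \<open>Chosen so that the squared weight \<open>exp (- 2 * v\<^sup>2 / T)\<close> is a
    multiple of the centred normal density of variance \<open>T / 4\<close>.\<close>
  define \<sigma> where "\<sigma> = sqrt T / 2"
  have \<sigma>: "\<sigma> > 0" "2 * \<sigma>\<^sup>2 = T / 2"
    using assms by (auto simp: \<sigma>_def power_divide)
  obtain p where p: "p \<noteq> 0" "hermite m = poly p"
    using hermite_poly by blast
  \<comment> \<open>\<open>q\<close> absorbs the rescaling of the argument by \<open>sqrt T\<close>;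
    \<open>C\<close> below collects the squared normalisation of \<open>asym_hermite\<close> and
    undoes that of the density.\<close>
  define q where "q = pcompose p [:0, 1 / sqrt T:]"
  have "q \<noteq> 0"
    using p(1) assms by (simp add: q_def pcompose_eq_0_iff)
  define C where "C = (T powr (- 1 / 2) * (2 ^ m * fact m * sqrt pi) powr (- 1 / 2))\<^sup>2
    * sqrt (2 * pi * \<sigma>\<^sup>2)"
  have "C > 0"
    using assms \<sigma>(1) by (simp add: C_def)
  have "asym_hermite T m v * asym_hermite T m v = C * (normal_density 0 \<sigma> v * (poly q v)\<^sup>2)" for v
  proof -
    have "exp (- (v\<^sup>2) / T) * exp (- (v\<^sup>2) / T) = exp (- (v\<^sup>2) / (2 * \<sigma>\<^sup>2))"
      unfolding \<sigma>(2) by (simp flip: exp_add add: field_simps)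
    also have "\<dots> = sqrt (2 * pi * \<sigma>\<^sup>2) * normal_density 0 \<sigma> v"
      using \<sigma>(1) by (simp add: normal_density_def)
    finally have "exp (- (v\<^sup>2) / T) * exp (- (v\<^sup>2) / T) =
      sqrt (2 * pi * \<sigma>\<^sup>2) * normal_density 0 \<sigma> v" .
    moreover have "hermite m (v / sqrt T) = poly q v"
      by (simp add: p(2) q_def poly_pcompose)
    ultimately show ?thesis
      unfolding asym_hermite_def C_def power2_eq_square by (simp add: mult_ac)
  qed
  then have "gram_coeff T m m = C * (LINT v|lborel. normal_density 0 \<sigma> v * (poly q v)\<^sup>2)"
    by (simp add: gram_coeff_def)
  with \<open>C > 0\<close> integral_normal_density_poly_square_pos[OF \<sigma>(1) \<open>q \<noteq> 0\<close>]
  show ?thesis by simp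
qed

theorem lemma3p5:
  fixes T e :: real and N :: nat
  assumes "T > 0" and "e \<noteq> 0" and "N \<ge> 1"
  shows "gram_mat T N * field_mat T e N + transpose_mat (field_mat T e N) * gram_mat T N
           \<noteq> 0\<^sub>m (N + 1) (N + 1)"
    (is "?M \<noteq> _")
proof
  assume "?M = 0\<^sub>m (N + 1) (N + 1)"
  then have "?M $$ (N, N - 1) = 0" by simp
  moreover have "?M $$ (N, N - 1) =
      (\<Sum>k<N + 1. gram_coeff T N k * field_coeff T e k (N - 1))
    + (\<Sum>k<N + 1. field_coeff T e k N * gram_coeff T k (N - 1))"
    by (simp add: gram_mat_def field_mat_def scalar_prod_def atLeast0LessThan)
  \<comment> \<open>A nonzero entry in column \<open>N\<close> would have to lie in row
    \<open>N + 1\<close>, which the truncation cuts off.\<close>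
  moreover have "(\<Sum>k<N + 1. field_coeff T e k N * gram_coeff T k (N - 1)) = 0"
    by (intro sum.neutral) (auto simp: field_coeff_def)
  \<comment> \<open>Since \<open>N \<ge> 1\<close>, the natural number \<open>N - 1\<close> is the
    true predecessor, so only row \<open>k = N\<close> meets the subdiagonal in that column.\<close>
  moreover have "(\<Sum>k<N + 1. gram_coeff T N k * field_coeff T e k (N - 1))
      = (\<Sum>k\<in>{N}. gram_coeff T N k * field_coeff T e k (N - 1))"
    using assms(3) by (intro sum.mono_neutral_right) (auto simp: field_coeff_def)
  ultimately have "gram_coeff T N N * field_coeff T e N (N - 1) = 0" by simp
  moreover have "field_coeff T e N (N - 1) \<noteq> 0"
    using assms by (simp add: field_coeff_def)
  ultimately show False
    using gram_coeff_diag_pos[OF assms(1), of N] by simp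
qed

end
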